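(* Let $\mathbf{A}$ be a normal and quasicomplemented distributive nearlattice and let $F\subseteq A$. Then $F$ is an $\alpha$-filter if and only if $F$ is an $\alpha$-ideal-congruence-kernel, i.e. there exists an $\alpha$-ideal $I$ of $A$ with $F=\ker\theta(I)$.
   Context: A distributive nearlattice is a join-semilattice $\langle A,\vee,1\rangle$ with greatest element $1$ in which every principal filter $[a)=\{x\in A\colon a\le x\}$ is a bounded distributive lattice. A filter of $A$ is a subset containing $1$, upward closed, and closed under those binary meets that exist. An ideal is a non-empty subset that is downward closed and closed under $\vee$. For $a\in A$, $a^{\top}=\{x\in A\colon x\vee a=1\}$ and $a^{\top\top}=\{y\in A\colon y\vee x=1\text{ for all }x\in a^{\top}\}$. A filter $F$ is an $\alpha$-filter if $a^{\top\top}\subseteq F$ for all $a\in F$. An ideal $I$ is an $\alpha$-ideal if for each $a\in A$, $I\cap a^{\top\top}\neq\emptyset$ implies $a\in I$. For an ideal $I$, $\theta(I)=\{(a,b)\in A\times A\colon \exists i\in I\ (a\vee i=b\vee i)\}$ (a congruence of $\mathbf{A}$), and for a congruence $\theta$, $\ker\theta=\{a\in A\colon (a,1)\in\theta\}$. A prime ideal is a proper ideal $P$ with $a\wedge b\in P\Rightarrow a\in P$ or $b\in P$ whenever $a\wedge b$ exists; a maximal ideal is a proper ideal not properly contained in any proper ideal. $\mathbf{A}$ is normal if each prime ideal is contained in a unique maximal ideal; $\mathbf{A}$ is quasicomplemented if for each $a\in A$ there exists $b\in A$ with $a^{\top\top}=b^{\top}$. *)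

theory Defs
  imports Main
begin

text \<open>Binary infima and suprema relative to the order induced on a subset \<open>S\<close>, as relations
  because they need not exist.\<close>

definition (in order) is_inf_on :: "'a set \<Rightarrow> 'a \<Rightarrow> 'a \<Rightarrow> 'a \<Rightarrow> bool" where
  "is_inf_on S x y m \<longleftrightarrow>
     m \<in> S \<and> m \<le> x \<and> m \<le> y \<and> (\<forall>z\<in>S. z \<le> x \<and> z \<le> y \<longrightarrow> z \<le> m)"

definition (in order) is_sup_on :: "'a set \<Rightarrow> 'a \<Rightarrow> 'a \<Rightarrow> 'a \<Rightarrow> bool" where
  "is_sup_on S x y s \<longleftrightarrow>
     s \<in> S \<and> x \<le> s \<and> y \<le> s \<and> (\<forall>z\<in>S. x \<le> z \<and> y \<le> z \<longrightarrow> s \<le> z)"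

definition (in order) lattice_on :: "'a set \<Rightarrow> bool" where
  "lattice_on S \<longleftrightarrow>
     (\<forall>x\<in>S. \<forall>y\<in>S. (\<exists>m. is_inf_on S x y m) \<and> (\<exists>s. is_sup_on S x y s))"

text \<open>The law \<open>x \<and> (y \<or> z) = (x \<and> y) \<or> (x \<and> z)\<close>, in relational form.\<close>

definition (in order) distributive_on :: "'a set \<Rightarrow> bool" where
  "distributive_on S \<longleftrightarrow>
     (\<forall>x\<in>S. \<forall>y\<in>S. \<forall>z\<in>S. \<forall>s m m1 m2.
        is_sup_on S y z s \<longrightarrow> is_inf_on S x s m \<longrightarrow>
        is_inf_on S x y m1 \<longrightarrow> is_inf_on S x z m2 \<longrightarrow> is_sup_on S m1 m2 m)"

definition (in order) bounded_on :: "'a set \<Rightarrow> bool" where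
  "bounded_on S \<longleftrightarrow> (\<exists>l\<in>S. \<forall>x\<in>S. l \<le> x) \<and> (\<exists>g\<in>S. \<forall>x\<in>S. x \<le> g)"

definition (in order) bounded_distributive_lattice_on :: "'a set \<Rightarrow> bool" where
  "bounded_distributive_lattice_on S \<longleftrightarrow> lattice_on S \<and> distributive_on S \<and> bounded_on S"

text \<open>The nearlattice is the whole type; its greatest element \<open>1\<close> is \<^const>\<open>top\<close>, and the
  principal filter \<open>[a)\<close> is \<open>{a..}\<close>.\<close>

class distributive_nearlattice = semilattice_sup + order_top +
  assumes principal_filter: "bounded_distributive_lattice_on {a..}"

definition nl_filter :: "'a::distributive_nearlattice set \<Rightarrow> bool" where
  "nl_filter F \<longleftrightarrow>
     top \<in> F \<and>
     (\<forall>x y. x \<in> F \<longrightarrow> x \<le> y \<longrightarrow> y \<in> F) \<and>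
     (\<forall>x y m. x \<in> F \<longrightarrow> y \<in> F \<longrightarrow> is_inf_on UNIV x y m \<longrightarrow> m \<in> F)"

definition nl_ideal :: "'a::distributive_nearlattice set \<Rightarrow> bool" where
  "nl_ideal I \<longleftrightarrow>
     I \<noteq> {} \<and>
     (\<forall>x y. y \<in> I \<longrightarrow> x \<le> y \<longrightarrow> x \<in> I) \<and>
     (\<forall>x y. x \<in> I \<longrightarrow> y \<in> I \<longrightarrow> sup x y \<in> I)"

definition annihilator :: "'a::distributive_nearlattice \<Rightarrow> 'a set" where
  "annihilator a = {x. sup x a = top}"

definition biannihilator :: "'a::distributive_nearlattice \<Rightarrow> 'a set" where
  "biannihilator a = {y. \<forall>x\<in>annihilator a. sup y x = top}"

definition alpha_filter :: "'a::distributive_nearlattice set \<Rightarrow> bool" where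
  "alpha_filter F \<longleftrightarrow> nl_filter F \<and> (\<forall>a\<in>F. biannihilator a \<subseteq> F)"

definition alpha_ideal :: "'a::distributive_nearlattice set \<Rightarrow> bool" where
  "alpha_ideal I \<longleftrightarrow> nl_ideal I \<and> (\<forall>a. I \<inter> biannihilator a \<noteq> {} \<longrightarrow> a \<in> I)"

definition ideal_congruence :: "'a::distributive_nearlattice set \<Rightarrow> ('a \<times> 'a) set" where
  "ideal_congruence I = {(a, b). \<exists>i\<in>I. sup a i = sup b i}"

definition congruence_kernel :: "('a::distributive_nearlattice \<times> 'a) set \<Rightarrow> 'a set" where
  "congruence_kernel \<theta> = {a. (a, top) \<in> \<theta>}"

definition alpha_ideal_congruence_kernel :: "'a::distributive_nearlattice set \<Rightarrow> bool" where
  "alpha_ideal_congruence_kernel F \<longleftrightarrow>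
     (\<exists>I. alpha_ideal I \<and> F = congruence_kernel (ideal_congruence I))"

definition prime_ideal :: "'a::distributive_nearlattice set \<Rightarrow> bool" where
  "prime_ideal P \<longleftrightarrow>
     nl_ideal P \<and> P \<noteq> UNIV \<and>
     (\<forall>a b m. is_inf_on UNIV a b m \<longrightarrow> m \<in> P \<longrightarrow> a \<in> P \<or> b \<in> P)"

definition maximal_ideal :: "'a::distributive_nearlattice set \<Rightarrow> bool" where
  "maximal_ideal M \<longleftrightarrow>
     nl_ideal M \<and> M \<noteq> UNIV \<and> (\<nexists>J. nl_ideal J \<and> J \<noteq> UNIV \<and> M \<subset> J)"

definition normal_nearlattice :: "'a::distributive_nearlattice itself \<Rightarrow> bool" where
  "normal_nearlattice _ \<longleftrightarrow>
     (\<forall>P::'a set. prime_ideal P \<longrightarrow> (\<exists>!M. maximal_ideal M \<and> P \<subseteq> M))"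

definition quasicomplemented_nearlattice :: "'a::distributive_nearlattice itself \<Rightarrow> bool" where
  "quasicomplemented_nearlattice _ \<longleftrightarrow>
     (\<forall>a::'a. \<exists>b. biannihilator a = annihilator b)"

end

theory Submission
  imports Defs
begin

text \<open>The kernel of \<open>\<theta>(I)\<close> is the union of the \<open>\<alpha>\<close>-filters \<open>i\<^sup>\<top>\<close> with \<open>i \<in> I\<close>, and this union is
  directed, so it is an \<open>\<alpha>\<close>-filter. Conversely, given an \<open>\<alpha>\<close>-filter \<open>F\<close>, take
  \<open>I = {x. x\<^sup>\<top> \<subseteq> F}\<close>. If \<open>a \<in> F\<close> and \<open>a\<^sup>\<top>\<^sup>\<top> = b\<^sup>\<top>\<close>, then \<open>b \<in> I\<close> and \<open>a \<in> b\<^sup>\<top>\<close>, so \<open>F\<close> is the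
  kernel of \<open>\<theta>(I)\<close>. Normality makes \<open>I\<close> closed under joins. Indeed, if an ideal \<open>P\<close> misses
  \<open>x\<^sup>\<top>\<close>, then some maximal ideal contains both \<open>P\<close> and \<open>x\<close>. If \<open>P\<close> is prime, only one maximal
  ideal is available, so \<open>P\<close> misses \<open>(x \<or> y)\<^sup>\<top>\<close> as soon as it misses \<open>x\<^sup>\<top>\<close> and \<open>y\<^sup>\<top>\<close>; and
  prime ideals separate \<open>F\<close> from the elements outside \<open>F\<close>.\<close>

lemma semilattice_sup_top [simp]:
  fixes x :: "'a::{semilattice_sup,order_top}"
  shows "sup x top = top" and "sup top x = top"
  by (rule top_le, simp)+

lemma le_sup_decompose:
  fixes m w r a :: "'a::distributive_nearlattice"
  assumes lower: "m \<le> w" "m \<le> r" "m \<le> a" and w: "w \<le> sup r a"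
  obtains u v where "w = sup u v" "u \<le> r" "v \<le> a" "m \<le> v"
proof -
  have lattice: "lattice_on {m..}" and distrib: "distributive_on {m..}"
    using principal_filter[of m] by (auto simp: bounded_distributive_lattice_on_def)
  obtain u where u: "is_inf_on {m..} w r u"
    using lattice lower unfolding lattice_on_def by auto
  obtain v where v: "is_inf_on {m..} w a v"
    using lattice lower unfolding lattice_on_def by auto
  have "is_sup_on {m..} r a (sup r a)"
    using lower by (auto simp: is_sup_on_def intro: le_supI1)
  moreover have "is_inf_on {m..} w (sup r a) w"
    using lower w by (auto simp: is_inf_on_def)
  ultimately have "is_sup_on {m..} u v w"
    using distrib u v lower unfolding distributive_on_def by (meson atLeast_iff)
  moreover have "sup u v \<in> {m..}"
    using u by (auto simp: is_inf_on_def intro: le_supI1)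
  ultimately have "w = sup u v"
    by (auto simp: is_sup_on_def intro!: order.antisym)
  with u v show thesis
    using that by (auto simp: is_inf_on_def)
qed

lemma is_inf_on_sup_distrib:
  fixes a b m r :: "'a::distributive_nearlattice"
  assumes "is_inf_on UNIV a b m"
  shows "is_inf_on UNIV (sup r a) (sup r b) (sup r m)"
proof -
  define p where "p = sup r m"
  have m: "m \<le> a" "m \<le> b" and greatest: "\<And>z. z \<le> a \<Longrightarrow> z \<le> b \<Longrightarrow> z \<le> m"
    using assms by (auto simp: is_inf_on_def)
  have "m \<le> p" by (simp add: p_def)
  have p: "sup p a = sup r a" "sup p b = sup r b"
    using m by (simp_all add: p_def sup_assoc sup_absorb2)
  have "z \<le> p" if z: "z \<le> sup r a" "z \<le> sup r b" for z
  proof -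
    have "sup z m \<le> sup p a" and below_b: "sup z m \<le> sup p b"
      using z m by (simp_all add: p le_supI2)
    then obtain u v where uv: "sup z m = sup u v" "u \<le> p" "v \<le> a" "m \<le> v"
      using le_sup_decompose[of m "sup z m" p a] \<open>m \<le> p\<close> m by auto
    have "v \<le> sup u v" by simp
    also have "\<dots> \<le> sup p b" using below_b uv(1) by simp
    finally have "v \<le> sup p b" .
    then obtain u' v' where uv': "v = sup u' v'" "u' \<le> p" "v' \<le> b"
      using le_sup_decompose[OF uv(4) \<open>m \<le> p\<close> m(2)] by blast
    have "v' \<le> m" using uv(3) uv' by (intro greatest) simp_all
    then have "sup z m \<le> p" using uv uv' \<open>m \<le> p\<close> by simp
    then show "z \<le> p" by simp
  qed
  then show ?thesis
    using m by (auto simp: is_inf_on_def p_def intro: le_supI2)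
qed

subsection \<open>Filters and ideals\<close>

lemma nl_filterI:
  assumes "top \<in> F"
    and "\<And>x y. x \<in> F \<Longrightarrow> x \<le> y \<Longrightarrow> y \<in> F"
    and "\<And>x y m. x \<in> F \<Longrightarrow> y \<in> F \<Longrightarrow> is_inf_on UNIV x y m \<Longrightarrow> m \<in> F"
  shows "nl_filter F"
  using assms unfolding nl_filter_def by blast

lemma
  assumes "nl_filter F"
  shows nl_filter_top: "top \<in> F"
    and nl_filter_upward: "x \<in> F \<Longrightarrow> x \<le> y \<Longrightarrow> y \<in> F"
    and nl_filter_inf: "x \<in> F \<Longrightarrow> y \<in> F \<Longrightarrow> is_inf_on UNIV x y m \<Longrightarrow> m \<in> F"
  using assms unfolding nl_filter_def by blast+

lemma nl_idealI:
  assumes "I \<noteq> {}"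
    and "\<And>x y. y \<in> I \<Longrightarrow> x \<le> y \<Longrightarrow> x \<in> I"
    and "\<And>x y. x \<in> I \<Longrightarrow> y \<in> I \<Longrightarrow> sup x y \<in> I"
  shows "nl_ideal I"
  using assms unfolding nl_ideal_def by blast

lemma
  assumes "nl_ideal I"
  shows nl_ideal_nonempty: "I \<noteq> {}"
    and nl_ideal_downward: "y \<in> I \<Longrightarrow> x \<le> y \<Longrightarrow> x \<in> I"
    and nl_ideal_sup: "x \<in> I \<Longrightarrow> y \<in> I \<Longrightarrow> sup x y \<in> I"
  using assms unfolding nl_ideal_def by blast+

lemma nl_ideal_proper_iff: "nl_ideal I \<Longrightarrow> I \<noteq> UNIV \<longleftrightarrow> top \<notin> I"
  using nl_ideal_downward top_greatest by blast

lemma nl_ideal_atMost: "nl_ideal {..z}"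
  by (rule nl_idealI) auto

lemma nl_ideal_directed_Union:
  assumes "\<I> \<noteq> {}" and ideal: "\<And>I. I \<in> \<I> \<Longrightarrow> nl_ideal I"
    and directed: "\<And>I J. I \<in> \<I> \<Longrightarrow> J \<in> \<I> \<Longrightarrow> \<exists>K\<in>\<I>. I \<union> J \<subseteq> K"
  shows "nl_ideal (\<Union>\<I>)"
proof (rule nl_idealI)
  show "\<Union>\<I> \<noteq> {}"
    using assms(1) nl_ideal_nonempty[OF ideal] by auto
next
  fix x y assume "y \<in> \<Union>\<I>" "x \<le> y"
  then show "x \<in> \<Union>\<I>" using nl_ideal_downward[OF ideal] by blast
next
  fix x y assume "x \<in> \<Union>\<I>" "y \<in> \<Union>\<I>"
  then obtain K where "K \<in> \<I>" "x \<in> K" "y \<in> K" using directed by blast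
  then show "sup x y \<in> \<Union>\<I>" using nl_ideal_sup[OF ideal] by blast
qed

lemma alpha_filter_directed_Union:
  assumes "\<F> \<noteq> {}" and alpha: "\<And>F. F \<in> \<F> \<Longrightarrow> alpha_filter F"
    and directed: "\<And>F G. F \<in> \<F> \<Longrightarrow> G \<in> \<F> \<Longrightarrow> \<exists>H\<in>\<F>. F \<union> G \<subseteq> H"
  shows "alpha_filter (\<Union>\<F>)"
proof -
  have filter: "nl_filter F" if "F \<in> \<F>" for F
    using alpha[OF that] by (simp add: alpha_filter_def)
  have "nl_filter (\<Union>\<F>)"
  proof (rule nl_filterI)
    show "top \<in> \<Union>\<F>" using assms(1) nl_filter_top[OF filter] by auto
  next
    fix x y assume "x \<in> \<Union>\<F>" "x \<le> y"
    then show "y \<in> \<Union>\<F>" using nl_filter_upward[OF filter] by blast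
  next
    fix x y m assume "x \<in> \<Union>\<F>" "y \<in> \<Union>\<F>" and inf: "is_inf_on UNIV x y m"
    then obtain H where "H \<in> \<F>" "x \<in> H" "y \<in> H" using directed by blast
    then show "m \<in> \<Union>\<F>" using nl_filter_inf[OF filter _ _ inf] by blast
  qed
  then show ?thesis
    using alpha unfolding alpha_filter_def by blast
qed

definition ideal_adjoin :: "'a::distributive_nearlattice set \<Rightarrow> 'a \<Rightarrow> 'a set" where
  "ideal_adjoin I a = {x. \<exists>i\<in>I. x \<le> sup i a}"

lemma nl_ideal_adjoin:
  assumes "nl_ideal I"
  shows "nl_ideal (ideal_adjoin I a)"
proof (rule nl_idealI)
  show "ideal_adjoin I a \<noteq> {}"
    using nl_ideal_nonempty[OF assms] by (auto simp: ideal_adjoin_def)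
next
  fix x y assume "y \<in> ideal_adjoin I a" "x \<le> y"
  then show "x \<in> ideal_adjoin I a" by (auto simp: ideal_adjoin_def intro: order_trans)
next
  fix x y assume "x \<in> ideal_adjoin I a" "y \<in> ideal_adjoin I a"
  then obtain i j where ij: "i \<in> I" "j \<in> I" "x \<le> sup i a" "y \<le> sup j a"
    by (auto simp: ideal_adjoin_def)
  have "sup x y \<le> sup (sup i a) (sup j a)" using ij by (intro sup_mono)
  also have "\<dots> = sup (sup i j) a" by (simp add: ac_simps)
  finally show "sup x y \<in> ideal_adjoin I a"
    using nl_ideal_sup[OF assms] ij by (auto simp: ideal_adjoin_def)
qed

lemma subset_ideal_adjoin: "I \<subseteq> ideal_adjoin I a"
  unfolding ideal_adjoin_def by (blast intro: sup_ge1)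

lemma mem_ideal_adjoin: "nl_ideal I \<Longrightarrow> a \<in> ideal_adjoin I a"
  using nl_ideal_nonempty by (auto simp: ideal_adjoin_def)

subsection \<open>Maximal and prime ideals\<close>

definition maximal_ideal_avoiding :: "'a::distributive_nearlattice set \<Rightarrow> 'a set \<Rightarrow> bool" where
  "maximal_ideal_avoiding S M \<longleftrightarrow>
     nl_ideal M \<and> M \<inter> S = {} \<and> (\<forall>J. nl_ideal J \<longrightarrow> M \<subseteq> J \<longrightarrow> J \<inter> S = {} \<longrightarrow> J = M)"

lemma maximal_ideal_avoiding_top_iff: "maximal_ideal_avoiding {top} M \<longleftrightarrow> maximal_ideal M"
  unfolding maximal_ideal_avoiding_def maximal_ideal_def using nl_ideal_proper_iff by auto

lemma exists_maximal_ideal_avoiding: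
  assumes "nl_ideal I" "I \<inter> S = {}"
  obtains M where "maximal_ideal_avoiding S M" "I \<subseteq> M"
proof -
  define \<A> where "\<A> = {J. nl_ideal J \<and> I \<subseteq> J \<and> J \<inter> S = {}}"
  have "\<exists>M\<in>\<A>. \<forall>J\<in>\<A>. M \<subseteq> J \<longrightarrow> J = M"
  proof (rule subset_Zorn_nonempty)
    show "\<A> \<noteq> {}" using assms by (auto simp: \<A>_def)
  next
    fix \<C> assume "\<C> \<noteq> {}" and "subset.chain \<A> \<C>"
    then have "\<C> \<subseteq> \<A>" and total: "\<And>J K. J \<in> \<C> \<Longrightarrow> K \<in> \<C> \<Longrightarrow> J \<subseteq> K \<or> K \<subseteq> J"
      by (auto simp: subset_chain_def)
    then have members: "nl_ideal J" "I \<subseteq> J" "J \<inter> S = {}" if "J \<in> \<C>" for J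
      using that by (auto simp: \<A>_def)
    have "\<exists>L\<in>\<C>. J \<union> K \<subseteq> L" if "J \<in> \<C>" "K \<in> \<C>" for J K
      using total[OF that] that by (metis Un_absorb1 Un_absorb2 order_refl)
    then have "nl_ideal (\<Union>\<C>)"
      using \<open>\<C> \<noteq> {}\<close> members(1) by (intro nl_ideal_directed_Union)
    moreover have "I \<subseteq> \<Union>\<C>" using \<open>\<C> \<noteq> {}\<close> members(2) by blast
    moreover have "\<Union>\<C> \<inter> S = {}" using members(3) by blast
    ultimately show "\<Union>\<C> \<in> \<A>" by (simp add: \<A>_def)
  qed
  then obtain M where "M \<in> \<A>" "\<forall>J\<in>\<A>. M \<subseteq> J \<longrightarrow> J = M" by blast
  then show thesis
    by (intro that[of M]) (auto simp: maximal_ideal_avoiding_def \<A>_def)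
qed

lemma maximal_ideal_avoiding_filter_sup_mem:
  assumes P: "maximal_ideal_avoiding F P" and F: "nl_filter F" and "a \<notin> P"
  obtains p where "p \<in> P" "sup p a \<in> F"
proof -
  have ideal: "nl_ideal P" using P by (simp add: maximal_ideal_avoiding_def)
  have "ideal_adjoin P a \<noteq> P" using mem_ideal_adjoin[OF ideal] \<open>a \<notin> P\<close> by blast
  then have "ideal_adjoin P a \<inter> F \<noteq> {}"
    using P nl_ideal_adjoin[OF ideal] subset_ideal_adjoin
    unfolding maximal_ideal_avoiding_def by blast
  then show thesis
    using that nl_filter_upward[OF F] by (auto simp: ideal_adjoin_def)
qed

lemma maximal_ideal_avoiding_filter_prime:
  assumes P: "maximal_ideal_avoiding F P" and F: "nl_filter F"
  shows "prime_ideal P"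
  unfolding prime_ideal_def
proof (intro conjI allI impI)
  show ideal: "nl_ideal P" using P by (simp add: maximal_ideal_avoiding_def)
  have disjoint: "P \<inter> F = {}" using P by (simp add: maximal_ideal_avoiding_def)
  then show "P \<noteq> UNIV" using nl_filter_top[OF F] by blast
  fix a b m assume inf: "is_inf_on UNIV a b m" and "m \<in> P"
  show "a \<in> P \<or> b \<in> P"
  proof (rule ccontr)
    assume "\<not> (a \<in> P \<or> b \<in> P)"
    then obtain p q where pq: "p \<in> P" "q \<in> P" "sup p a \<in> F" "sup q b \<in> F"
      using maximal_ideal_avoiding_filter_sup_mem[OF P F] by metis
    define r where "r = sup p q"
    have "sup p a \<le> sup r a" "sup q b \<le> sup r b"
      unfolding r_def by (auto intro: le_supI1)
    then have "sup r a \<in> F" "sup r b \<in> F"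
      using pq(3,4) nl_filter_upward[OF F] by blast+
    then have "sup r m \<in> F"
      using nl_filter_inf[OF F] is_inf_on_sup_distrib[OF inf] by blast
    moreover have "sup r m \<in> P"
      using pq \<open>m \<in> P\<close> by (simp add: r_def nl_ideal_sup[OF ideal])
    ultimately show False using disjoint by blast
  qed
qed

lemma exists_prime_ideal_separating:
  assumes "nl_filter F" "nl_ideal I" "I \<inter> F = {}"
  obtains P where "prime_ideal P" "I \<subseteq> P" "P \<inter> F = {}"
proof -
  obtain P where P: "maximal_ideal_avoiding F P" "I \<subseteq> P"
    using exists_maximal_ideal_avoiding assms(2,3) by blast
  with maximal_ideal_avoiding_filter_prime[OF P(1) assms(1)] show thesis
    using that by (simp add: maximal_ideal_avoiding_def)
qed

subsection \<open>Annihilators\<close>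

lemma annihilator_mono:
  assumes "x \<le> y"
  shows "annihilator x \<subseteq> annihilator y"
proof
  fix z assume "z \<in> annihilator x"
  moreover have "sup z x \<le> sup z y" using assms by (simp add: le_supI2)
  ultimately show "z \<in> annihilator y" by (simp add: annihilator_def top_unique)
qed

lemma mem_biannihilator_iff: "x \<in> biannihilator a \<longleftrightarrow> annihilator a \<subseteq> annihilator x"
  by (auto simp: biannihilator_def annihilator_def sup_commute)

lemma alpha_filter_annihilator: "alpha_filter (annihilator a)"
proof -
  have "nl_filter (annihilator a)"
  proof (rule nl_filterI)
    show "top \<in> annihilator a" by (simp add: annihilator_def)
  next
    fix x y assume "x \<in> annihilator a" and "x \<le> y"
    then show "y \<in> annihilator a"
      using sup_mono[OF \<open>x \<le> y\<close> order_refl, of a] by (simp add: annihilator_def top_unique)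
  next
    fix x y m assume "x \<in> annihilator a" "y \<in> annihilator a" "is_inf_on UNIV x y m"
    then have "is_inf_on UNIV top top (sup a m)"
      using is_inf_on_sup_distrib[of x y m a] by (simp add: annihilator_def sup_commute)
    then have "top \<le> sup a m" by (simp add: is_inf_on_def)
    then show "m \<in> annihilator a" by (simp add: annihilator_def sup_commute top_unique)
  qed
  moreover have "biannihilator x \<subseteq> annihilator a" if "x \<in> annihilator a" for x
    using that by (auto simp: biannihilator_def annihilator_def sup_commute)
  ultimately show ?thesis by (simp add: alpha_filter_def)
qed

lemma exists_maximal_ideal_containing_insert:
  assumes I: "nl_ideal I" and disjoint: "I \<inter> annihilator a = {}"
  obtains M where "maximal_ideal M" "insert a I \<subseteq> M"
proof -
  have "top \<notin> ideal_adjoin I a"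
    using disjoint by (auto simp: ideal_adjoin_def annihilator_def top_unique)
  then obtain M where "maximal_ideal M" "ideal_adjoin I a \<subseteq> M"
    using exists_maximal_ideal_avoiding[OF nl_ideal_adjoin[OF I], of a "{top}"]
    by (auto simp: maximal_ideal_avoiding_top_iff)
  then show thesis
    using that mem_ideal_adjoin[OF I] subset_ideal_adjoin by blast
qed

lemma normal_prime_ideal_disjoint_annihilator_sup:
  fixes P :: "'a::distributive_nearlattice set"
  assumes normal: "normal_nearlattice TYPE('a)" and P: "prime_ideal P"
    and x: "P \<inter> annihilator x = {}" and y: "P \<inter> annihilator y = {}"
  shows "P \<inter> annihilator (sup x y) = {}"
proof (rule ccontr)
  have ideal: "nl_ideal P" using P by (simp add: prime_ideal_def)
  obtain M where M: "maximal_ideal M" "insert x P \<subseteq> M"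
    using exists_maximal_ideal_containing_insert[OF ideal x] by blast
  obtain M' where M': "maximal_ideal M'" "insert y P \<subseteq> M'"
    using exists_maximal_ideal_containing_insert[OF ideal y] by blast
  have "M' = M"
    using normal P M M' unfolding normal_nearlattice_def by auto
  assume "P \<inter> annihilator (sup x y) \<noteq> {}"
  then obtain z where "z \<in> P" "sup z (sup x y) = top" by (auto simp: annihilator_def)
  moreover have M_ideal: "nl_ideal M" and "top \<notin> M"
    using M(1) nl_ideal_proper_iff by (auto simp: maximal_ideal_def)
  moreover have "x \<in> M" "y \<in> M" "z \<in> M"
    using M(2) M'(2) \<open>M' = M\<close> \<open>z \<in> P\<close> by auto
  then have "sup z (sup x y) \<in> M"
    by (intro nl_ideal_sup[OF M_ideal])
  ultimately show False by simp
qed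

lemma normal_annihilator_sup_subset_filter:
  fixes F :: "'a::distributive_nearlattice set"
  assumes normal: "normal_nearlattice TYPE('a)" and F: "nl_filter F"
    and "annihilator x \<subseteq> F" "annihilator y \<subseteq> F"
  shows "annihilator (sup x y) \<subseteq> F"
proof (rule subsetI, rule ccontr)
  fix z assume z: "z \<in> annihilator (sup x y)" and "z \<notin> F"
  then have "{..z} \<inter> F = {}" using nl_filter_upward[OF F] by blast
  then obtain P where P: "prime_ideal P" "{..z} \<subseteq> P" "P \<inter> F = {}"
    using exists_prime_ideal_separating[OF F nl_ideal_atMost] by blast
  then have "P \<inter> annihilator (sup x y) = {}"
    using assms(3,4) by (intro normal_prime_ideal_disjoint_annihilator_sup[OF normal]) auto
  with z P(2) show False by auto
qed

subsection \<open>Kernels of ideal congruences\<close>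

lemma congruence_kernel_ideal_congruence:
  "congruence_kernel (ideal_congruence I) = (\<Union>i\<in>I. annihilator i)"
  by (auto simp: congruence_kernel_def ideal_congruence_def annihilator_def)

lemma alpha_filter_ideal_congruence_kernel:
  assumes "nl_ideal I"
  shows "alpha_filter (congruence_kernel (ideal_congruence I))"
  unfolding congruence_kernel_ideal_congruence
proof (rule alpha_filter_directed_Union)
  show "annihilator ` I \<noteq> {}" using nl_ideal_nonempty[OF assms] by simp
next
  fix F assume "F \<in> annihilator ` I"
  then show "alpha_filter F" using alpha_filter_annihilator by blast
next
  fix F G assume "F \<in> annihilator ` I" "G \<in> annihilator ` I"
  then obtain i j where "i \<in> I" "j \<in> I" "F = annihilator i" "G = annihilator j" by blast
  moreover have "annihilator i \<union> annihilator j \<subseteq> annihilator (sup i j)"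
    by (simp add: annihilator_mono)
  ultimately show "\<exists>H\<in>annihilator ` I. F \<union> G \<subseteq> H"
    using nl_ideal_sup[OF assms] by blast
qed

definition annihilated_within :: "'a::distributive_nearlattice set \<Rightarrow> 'a set" where
  "annihilated_within F = {x. annihilator x \<subseteq> F}"

lemma alpha_ideal_annihilated_within:
  fixes F :: "'a::distributive_nearlattice set"
  assumes normal: "normal_nearlattice TYPE('a)" and F: "nl_filter F"
    and nonempty: "annihilated_within F \<noteq> {}"
  shows "alpha_ideal (annihilated_within F)"
proof -
  have "nl_ideal (annihilated_within F)"
  proof (rule nl_idealI)
    fix x y assume "y \<in> annihilated_within F" "x \<le> y"
    then show "x \<in> annihilated_within F"
      using annihilator_mono by (auto simp: annihilated_within_def)
  next
    fix x y assume "x \<in> annihilated_within F" "y \<in> annihilated_within F"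
    then show "sup x y \<in> annihilated_within F"
      using normal_annihilator_sup_subset_filter[OF normal F]
      by (simp add: annihilated_within_def)
  qed (rule nonempty)
  moreover have "a \<in> annihilated_within F"
    if "annihilated_within F \<inter> biannihilator a \<noteq> {}" for a
    using that by (fastforce simp: annihilated_within_def mem_biannihilator_iff)
  ultimately show ?thesis by (simp add: alpha_ideal_def)
qed

lemma congruence_kernel_annihilated_within:
  fixes F :: "'a::distributive_nearlattice set"
  assumes quasi: "quasicomplemented_nearlattice TYPE('a)" and F: "alpha_filter F"
  shows "congruence_kernel (ideal_congruence (annihilated_within F)) = F"
  unfolding congruence_kernel_ideal_congruence
proof
  show "(\<Union>i\<in>annihilated_within F. annihilator i) \<subseteq> F"
    by (auto simp: annihilated_within_def)
next
  show "F \<subseteq> (\<Union>i\<in>annihilated_within F. annihilator i)"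
  proof
    fix a assume "a \<in> F"
    obtain b where b: "biannihilator a = annihilator b"
      using quasi by (auto simp: quasicomplemented_nearlattice_def)
    have "b \<in> annihilated_within F"
      using F \<open>a \<in> F\<close> by (simp add: alpha_filter_def annihilated_within_def flip: b)
    moreover have "a \<in> annihilator b"
      by (simp add: mem_biannihilator_iff flip: b)
    ultimately show "a \<in> (\<Union>i\<in>annihilated_within F. annihilator i)" by blast
  qed
qed

theorem theorem3p15:
  fixes F :: "'a::distributive_nearlattice set"
  assumes "normal_nearlattice TYPE('a)"
    and "quasicomplemented_nearlattice TYPE('a)"
  shows "alpha_filter F \<longleftrightarrow> alpha_ideal_congruence_kernel F"
proof
  assume "alpha_filter F"
  then have filter: "nl_filter F" by (simp add: alpha_filter_def)
  have kernel: "congruence_kernel (ideal_congruence (annihilated_within F)) = F"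
    using assms(2) \<open>alpha_filter F\<close> by (rule congruence_kernel_annihilated_within)
  then have "annihilated_within F \<noteq> {}"
    using nl_filter_top[OF filter] by (auto simp: congruence_kernel_ideal_congruence)
  with assms(1) filter have "alpha_ideal (annihilated_within F)"
    by (rule alpha_ideal_annihilated_within)
  with kernel show "alpha_ideal_congruence_kernel F"
    unfolding alpha_ideal_congruence_kernel_def by blast
next
  assume "alpha_ideal_congruence_kernel F"
  then show "alpha_filter F"
    using alpha_filter_ideal_congruence_kernel
    by (auto simp: alpha_ideal_congruence_kernel_def alpha_ideal_def)
qed

end
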